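(* Let $(X,d)$ be a convergence-symmetric length space. If $X$ is complete and locally compact, then every bounded closed subset of $X$ is compact.
   Context: A metric on a non-empty set $X$ is a function $d:X\times X\to[0,\infty)$ with $d(x,y)=0$ iff $x=y$, and $d(x,z)\le d(x,y)+d(y,z)$ for all $x,y,z$; symmetry is NOT assumed. $(X,d)$ is convergence-symmetric if for any two sequences $(p_n),(q_n)$ in $X$, $d(p_n,q_n)\to0$ if and only if $d(q_n,p_n)\to0$. The topology of such a space is the one induced by the symmetric metric $d_{\mathrm{arith}}(x,y)=\frac12(d(x,y)+d(y,x))$; closed, compact, locally compact and continuous refer to this topology. A sequence $(x_n)$ is Cauchy if for every $\epsilon>0$ there is $N$ with $d(x_i,x_{i+k})<\epsilon$ for all $i\ge N$, $k\ge0$ (in a convergence-symmetric space this is equivalent to the same condition with $d(x_{i+k},x_i)$); the space is complete if every Cauchy sequence converges. A subset $A$ is bounded if $\sup\{d(r,s):r,s\in A\}<\infty$. A path is a continuous map $c:[a,b]\to X$; its length is $l(c)=\sup\sum_{i=0}^{n-1}d(c(t_i),c(t_{i+1}))$ over all partitions $a=t_0\le t_1\le\dots\le t_n=b$; $c$ is rectifiable if $l(c)<\infty$. $(X,d)$ is a length space if for all $x,y\in X$, $d(x,y)$ equals the infimum of the lengths of rectifiable paths from $x$ to $y$. *)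

theory Defs
  imports "HOL-Analysis.Analysis"
begin

text \<open>Metrics without the symmetry axiom, on a non-empty carrier set \<open>M\<close>; as in the library
  locale \<open>Metric_space\<close> the distance is a total function, here constrained only on \<open>M\<close>.\<close>

locale asym_metric_space =
  fixes M :: "'a set" and d :: "'a \<Rightarrow> 'a \<Rightarrow> real"
  assumes nonempty: "M \<noteq> {}"
    and nonneg: "\<lbrakk>x \<in> M; y \<in> M\<rbrakk> \<Longrightarrow> 0 \<le> d x y"
    and zero: "\<lbrakk>x \<in> M; y \<in> M\<rbrakk> \<Longrightarrow> d x y = 0 \<longleftrightarrow> x = y"
    and triangle: "\<lbrakk>x \<in> M; y \<in> M; z \<in> M\<rbrakk> \<Longrightarrow> d x z \<le> d x y + d y z"
begin

text \<open>The value \<open>0\<close> off \<open>M\<close> is only there because \<open>Metric_space\<close> demands non-negativity and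
  symmetry of the whole function; the induced topology does not depend on it.\<close>

definition d_arith :: "'a \<Rightarrow> 'a \<Rightarrow> real" where
  "d_arith x y = (if x \<in> M \<and> y \<in> M then (d x y + d y x) / 2 else 0)"

sublocale arith: Metric_space M d_arith
proof
  show "0 \<le> d_arith x y" for x y
    by (simp add: d_arith_def nonneg)
  show "d_arith x y = d_arith y x" for x y
    by (simp add: d_arith_def)
  show "d_arith x y = 0 \<longleftrightarrow> x = y" if "x \<in> M" "y \<in> M" for x y
    using that nonneg[of x y] nonneg[of y x] zero[of x y] zero[of y x]
    by (auto simp: d_arith_def)
  show "d_arith x z \<le> d_arith x y + d_arith y z" if "x \<in> M" "y \<in> M" "z \<in> M" for x y z
    using that triangle[of x y z] triangle[of z y x]
    by (simp add: d_arith_def field_simps)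
qed

definition asym_topology :: "'a topology" where
  "asym_topology = arith.mtopology"

definition convergence_symmetric :: bool where
  "convergence_symmetric \<longleftrightarrow>
     (\<forall>p q :: nat \<Rightarrow> 'a. range p \<subseteq> M \<longrightarrow> range q \<subseteq> M \<longrightarrow>
        ((\<lambda>n. d (p n) (q n)) \<longlonglongrightarrow> 0 \<longleftrightarrow> (\<lambda>n. d (q n) (p n)) \<longlonglongrightarrow> 0))"

definition cauchy_seq :: "(nat \<Rightarrow> 'a) \<Rightarrow> bool" where
  "cauchy_seq x \<longleftrightarrow> range x \<subseteq> M \<and> (\<forall>\<epsilon>>0. \<exists>N. \<forall>i\<ge>N. \<forall>k. d (x i) (x (i + k)) < \<epsilon>)"

definition complete_space :: bool where
  "complete_space \<longleftrightarrow> (\<forall>x. cauchy_seq x \<longrightarrow> (\<exists>l. limitin asym_topology x l sequentially))"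

definition bounded_subset :: "'a set \<Rightarrow> bool" where
  "bounded_subset A \<longleftrightarrow> A \<subseteq> M \<and> bdd_above {d r s | r s. r \<in> A \<and> s \<in> A}"

definition path_on :: "real \<Rightarrow> real \<Rightarrow> (real \<Rightarrow> 'a) \<Rightarrow> bool" where
  "path_on a b c \<longleftrightarrow> a \<le> b \<and> continuous_map (top_of_set {a..b}) asym_topology c"

definition path_len :: "real \<Rightarrow> real \<Rightarrow> (real \<Rightarrow> 'a) \<Rightarrow> ereal" where
  "path_len a b c =
     Sup {ereal (\<Sum>i<n. d (c (t i)) (c (t (Suc i)))) | (n :: nat) (t :: nat \<Rightarrow> real).
            t 0 = a \<and> t n = b \<and> (\<forall>i<n. t i \<le> t (Suc i))}"

definition rectifiable :: "real \<Rightarrow> real \<Rightarrow> (real \<Rightarrow> 'a) \<Rightarrow> bool" where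
  "rectifiable a b c \<longleftrightarrow> path_on a b c \<and> path_len a b c < \<infinity>"

text \<open>Since the infimum of the empty set is \<open>\<infinity>\<close> in \<^typ>\<open>ereal\<close>, the equation forces any two
  points to be joined by a rectifiable path.\<close>

definition length_space :: bool where
  "length_space \<longleftrightarrow>
     (\<forall>x\<in>M. \<forall>y\<in>M. ereal (d x y) =
        Inf {path_len a b c | a b c. rectifiable a b c \<and> c a = x \<and> c b = y})"

end

end

theory Submission
  imports Defs
begin

text \<open>
  This is the Hopf--Rinow--Cohn-Vossen argument for a distance that need not be symmetric. Fix a
  centre \<open>p\<close> and consider the closed forward balls \<open>B(r) = {y. d p y \<le> r}\<close>; a bounded
  closed set is a closed subset of one of them, so it suffices that every \<open>B(r)\<close> is compact.
  If some ball is not compact, the radii with compact ball have a finite supremum \<open>R\<close>, and \<open>R\<close> is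
  contradictory from both sides:

  \<^item> \<open>B(R)\<close> is compact. A path of almost minimal length from \<open>p\<close> to a point of \<open>B(R)\<close> meets
    the sphere of radius \<open>R - \<eta>\<close> shortly before its end, so \<open>B(R)\<close> lies in an arbitrarily small
    neighbourhood of a compact ball \<open>B(R - \<eta>)\<close>. Hence \<open>B(R)\<close> is totally bounded, and it is closed
    in a complete space (\<open>compactin_forward_cball_limit\<close>).

  \<^item> A slightly larger ball is compact too. By local compactness some uniform neighbourhood of the
    compact set \<open>B(R)\<close> lies in a compact set, and by the same path argument \<open>B(R + \<eta>)\<close> lies in
    this neighbourhood (\<open>compactin_forward_cball_extend\<close>).

  Asymmetry enters only through closeness: a path controls the distance \<open>d z y\<close> from an
  intermediate point \<open>z\<close> to the end point \<open>y\<close>, whereas the topology, total boundedness and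
  completeness are those of the symmetrised distance. Convergence-symmetry bridges the two, because
  its sequential formulation is equivalent to a uniform one (\<open>convergence_symmetric_uniform\<close>).
\<close>

context asym_metric_space
begin

definition forward_cball :: "'a \<Rightarrow> real \<Rightarrow> 'a set" where
  "forward_cball p r = {y \<in> M. d p y \<le> r}"

lemma forward_cball_mono: "r \<le> s \<Longrightarrow> forward_cball p r \<subseteq> forward_cball p s"
  by (auto simp: forward_cball_def)

lemma d_le_d_arith:
  assumes "x \<in> M" "y \<in> M"
  shows "d x y \<le> 2 * d_arith x y" and "d y x \<le> 2 * d_arith x y"
  using assms nonneg[of x y] nonneg[of y x] by (auto simp: d_arith_def)

lemma continuous_map_d:
  assumes p: "p \<in> M"
  shows "continuous_map asym_topology euclideanreal (d p)"
proof -
  have "\<bar>d p y - d p z\<bar> \<le> 2 * d_arith y z" if "y \<in> M" "z \<in> M" for y z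
    using triangle[of p y z] triangle[of p z y] d_le_d_arith[of y z] p that by linarith
  then have "\<exists>U. openin arith.mtopology U \<and> y \<in> U \<and> (\<forall>z\<in>U. \<bar>d p y - d p z\<bar> < e)"
    if "y \<in> M" "e > 0" for y e
    using that by (intro exI[of _ "arith.mball y (e/2)"]) fastforce
  then show ?thesis
    using Met_TC.continuous_map_to_metric[of asym_topology "d p"]
    by (simp add: asym_topology_def dist_real_def)
qed

lemma closedin_forward_cball:
  assumes "p \<in> M"
  shows "closedin asym_topology (forward_cball p r)"
  using closedin_continuous_map_preimage[OF continuous_map_d[OF assms], of "{..r}"]
  by (simp add: asym_topology_def forward_cball_def)

text \<open>Otherwise there are pairs \<open>(x\<^sub>n, y\<^sub>n)\<close> with \<open>d x\<^sub>n y\<^sub>n \<longrightarrow> 0\<close> while \<open>d y\<^sub>n x\<^sub>n\<close> stays away from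
  \<open>0\<close>; convergence-symmetry speaks of arbitrary pairs of sequences, not only of convergent ones,
  which is what makes \<open>\<delta>\<close> uniform.\<close>

lemma convergence_symmetric_uniform:
  assumes cs: "convergence_symmetric" and "\<epsilon> > 0"
  obtains \<delta> where "\<delta> > 0" "\<And>x y. \<lbrakk>x \<in> M; y \<in> M; d x y < \<delta>\<rbrakk> \<Longrightarrow> d_arith x y < \<epsilon>"
proof -
  have "\<exists>\<delta>>0. \<forall>x\<in>M. \<forall>y\<in>M. d x y < \<delta> \<longrightarrow> d y x < \<epsilon>"
  proof (rule ccontr)
    assume "\<not> ?thesis"
    then have "\<exists>x y. x \<in> M \<and> y \<in> M \<and> d x y < \<delta> \<and> \<epsilon> \<le> d y x" if "\<delta> > 0" for \<delta>
      using that by (meson not_less)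
    then have "\<exists>x y. x \<in> M \<and> y \<in> M \<and> d x y < 1 / real (Suc n) \<and> \<epsilon> \<le> d y x" for n
      by simp
    then obtain x y where xy: "\<And>n. x n \<in> M \<and> y n \<in> M \<and> d (x n) (y n) < 1 / real (Suc n)
        \<and> \<epsilon> \<le> d (y n) (x n)"
      by metis
    have "(\<lambda>n. d (x n) (y n)) \<longlonglongrightarrow> 0"
    proof (rule tendsto_sandwich[OF _ _ tendsto_const LIMSEQ_inverse_real_of_nat])
      show "\<forall>\<^sub>F n in sequentially. 0 \<le> d (x n) (y n)"
        using xy nonneg by simp
      show "\<forall>\<^sub>F n in sequentially. d (x n) (y n) \<le> inverse (real (Suc n))"
        using xy by (simp add: inverse_eq_divide less_imp_le)
    qed
    then have "(\<lambda>n. d (y n) (x n)) \<longlonglongrightarrow> 0"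
      using cs xy unfolding convergence_symmetric_def by blast
    then have "\<epsilon> \<le> 0"
      using xy by (intro LIMSEQ_le_const[where a = \<epsilon>]) auto
    with \<open>\<epsilon> > 0\<close> show False by simp
  qed
  then obtain \<delta> where "\<delta> > 0" and \<delta>: "\<And>x y. \<lbrakk>x \<in> M; y \<in> M; d x y < \<delta>\<rbrakk> \<Longrightarrow> d y x < \<epsilon>"
    by blast
  show thesis
  proof
    show "min \<delta> \<epsilon> > 0"
      using \<open>\<delta> > 0\<close> \<open>\<epsilon> > 0\<close> by simp
    show "d_arith x y < \<epsilon>" if "x \<in> M" "y \<in> M" "d x y < min \<delta> \<epsilon>" for x y
      using \<delta>[of x y] that by (simp add: d_arith_def)
  qed
qed

lemma complete_space_imp_mcomplete:
  assumes "complete_space"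
  shows "arith.mcomplete"
  unfolding arith.mcomplete_def
proof (intro allI impI)
  fix x assume x: "arith.MCauchy x"
  have "cauchy_seq x"
    unfolding cauchy_seq_def
  proof (intro conjI allI impI)
    show rx: "range x \<subseteq> M"
      using x by (simp add: arith.MCauchy_def)
    fix \<epsilon> :: real assume "\<epsilon> > 0"
    then obtain N where N: "\<And>m n. \<lbrakk>N \<le> m; N \<le> n\<rbrakk> \<Longrightarrow> d_arith (x m) (x n) < \<epsilon> / 2"
      using x unfolding arith.MCauchy_def by (meson half_gt_zero)
    have "d (x i) (x (i + k)) < \<epsilon>" if "N \<le> i" for i k
      using d_le_d_arith(1)[of "x i" "x (i + k)"] N[of i "i + k"] rx that
      by (auto simp: image_subset_iff)
    then show "\<exists>N. \<forall>i\<ge>N. \<forall>k. d (x i) (x (i + k)) < \<epsilon>"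
      by blast
  qed
  then show "\<exists>l. limitin arith.mtopology x l sequentially"
    using assms unfolding complete_space_def asym_topology_def by blast
qed

lemma path_len_ge_two_steps:
  assumes "a \<le> s" "s \<le> b"
  shows "ereal (d (c a) (c s) + d (c s) (c b)) \<le> path_len a b c"
proof -
  define t :: "nat \<Rightarrow> real" where "t = (\<lambda>i. if i = 0 then a else if i = 1 then s else b)"
  have "d (c a) (c s) + d (c s) (c b) = (\<Sum>i<2. d (c (t i)) (c (t (Suc i))))"
    by (simp add: t_def numeral_2_eq_2)
  moreover have "t 0 = a \<and> t 2 = b \<and> (\<forall>i<2. t i \<le> t (Suc i))"
    using assms by (auto simp: t_def)
  ultimately show ?thesis
    unfolding path_len_def by (intro Sup_upper) blast
qed

text \<open>Along a path from \<open>x\<close> to \<open>y\<close> shorter than \<open>d x y + \<epsilon>\<close> the continuous function \<open>d x\<close>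
  attains the value \<open>s\<close>; at such a point the first part of the path has length at least \<open>s\<close>, which
  leaves less than \<open>d x y - s + \<epsilon>\<close> for the rest.\<close>

lemma length_space_intermediate_point:
  assumes ls: "length_space" and xy: "x \<in> M" "y \<in> M"
    and s: "0 \<le> s" "s \<le> d x y" and "\<epsilon> > 0"
  obtains z where "z \<in> M" "d x z = s" "d z y < d x y - s + \<epsilon>"
proof -
  have "Inf {path_len a b c | a b c. rectifiable a b c \<and> c a = x \<and> c b = y} = ereal (d x y)"
    using ls xy unfolding length_space_def by simp
  also have "\<dots> < ereal (d x y + \<epsilon>)"
    using \<open>\<epsilon> > 0\<close> by simp
  finally have "Inf {path_len a b c | a b c. rectifiable a b c \<and> c a = x \<and> c b = y}
      < ereal (d x y + \<epsilon>)" .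
  then obtain a b c where c: "rectifiable a b c" "c a = x" "c b = y"
      and len: "path_len a b c < ereal (d x y + \<epsilon>)"
    unfolding Inf_less_iff by blast
  have "a \<le> b" and cont: "continuous_map (top_of_set {a..b}) asym_topology c"
    using c unfolding rectifiable_def path_on_def by auto
  have "continuous_on {a..b} (d x \<circ> c)"
    using continuous_map_compose[OF cont continuous_map_d[OF \<open>x \<in> M\<close>]] by simp
  then obtain t where t: "a \<le> t" "t \<le> b" "d x (c t) = s"
    using IVT'[of "d x \<circ> c" a s b] \<open>a \<le> b\<close> s c xy zero[of x x] by auto
  have "c t \<in> M"
    using continuous_map_image_subset_topspace[OF cont] t by (auto simp: asym_topology_def)
  moreover have "ereal (d x (c t) + d (c t) y) < ereal (d x y + \<epsilon>)"
    using le_less_trans[OF path_len_ge_two_steps[OF t(1,2), of c] len] c by simp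
  then have "d (c t) y < d x y - s + \<epsilon>"
    using t by simp
  ultimately show thesis
    using that t by blast
qed

text \<open>If \<open>d p y\<close> exceeds \<open>r\<close>, an almost shortest path from \<open>p\<close> to \<open>y\<close> has a point \<open>z\<close> with
  \<open>d p z = r\<close> and \<open>d z y < (s - r) + (\<delta> - (s - r)) = \<delta>\<close>, and uniform convergence-symmetry turns
  this one-sided bound into closeness in the symmetrised distance. That \<open>\<delta>\<close> depends on neither
  radius is what allows \<open>r\<close> to approach \<open>R\<close> from below in one application and \<open>s\<close> to exceed \<open>R\<close>
  in the other.\<close>

lemma forward_cball_subset_neighbourhood:
  assumes cs: "convergence_symmetric" and ls: "length_space" and p: "p \<in> M" and "\<epsilon> > 0"
  obtains \<delta> where "\<delta> > 0"
    "\<And>r s. \<lbrakk>0 \<le> r; s < r + \<delta>\<rbrakk> \<Longrightarrow> forward_cball p s \<subseteq> (\<Union>z\<in>forward_cball p r. arith.mball z \<epsilon>)"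
proof -
  obtain \<delta> where "\<delta> > 0" and \<delta>: "\<And>x y. \<lbrakk>x \<in> M; y \<in> M; d x y < \<delta>\<rbrakk> \<Longrightarrow> d_arith x y < \<epsilon>"
    using convergence_symmetric_uniform[OF cs \<open>\<epsilon> > 0\<close>] by blast
  have "\<exists>z\<in>forward_cball p r. y \<in> arith.mball z \<epsilon>"
    if r: "0 \<le> r" "s < r + \<delta>" and y: "y \<in> forward_cball p s" for r s y
  proof (cases "d p y \<le> r")
    case True
    then show ?thesis
      using y \<open>\<epsilon> > 0\<close> by (intro bexI[of _ y]) (auto simp: forward_cball_def)
  next
    case False
    have "y \<in> M" "d p y \<le> s"
      using y by (auto simp: forward_cball_def)
    then obtain z where z: "z \<in> M" "d p z = r" "d z y < d p y - r + (\<delta> - (s - r))"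
      using length_space_intermediate_point[OF ls p, of y r "\<delta> - (s - r)"] r False by auto
    then have "d z y < \<delta>"
      using \<open>d p y \<le> s\<close> by simp
    then show ?thesis
      using z \<delta> \<open>y \<in> M\<close> by (intro bexI[of _ z]) (auto simp: forward_cball_def)
  qed
  with \<open>\<delta> > 0\<close> show thesis
    by (intro that[of \<delta>]) blast+
qed

lemma compactin_forward_cball_limit:
  assumes cs: "convergence_symmetric" and ls: "length_space" and complete: "complete_space"
    and p: "p \<in> M" and "R > 0"
    and below: "\<And>r. \<lbrakk>0 \<le> r; r < R\<rbrakk> \<Longrightarrow> compactin asym_topology (forward_cball p r)"
  shows "compactin asym_topology (forward_cball p R)"
proof -
  have "arith.mtotally_bounded (forward_cball p R)"
    unfolding arith.mtotally_bounded_def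
  proof (intro allI impI)
    fix \<epsilon> :: real assume "\<epsilon> > 0"
    then obtain \<delta> where "\<delta> > 0" and \<delta>: "\<And>r s. \<lbrakk>0 \<le> r; s < r + \<delta>\<rbrakk>
        \<Longrightarrow> forward_cball p s \<subseteq> (\<Union>z\<in>forward_cball p r. arith.mball z (\<epsilon>/2))"
      using forward_cball_subset_neighbourhood[OF cs ls p, of "\<epsilon>/2"] by (metis half_gt_zero)
    define r where "r = max 0 (R - \<delta>/2)"
    have r: "0 \<le> r" "r < R" "R < r + \<delta>"
      using \<open>\<delta> > 0\<close> \<open>R > 0\<close> by (auto simp: r_def)
    have "arith.mtotally_bounded (forward_cball p r)"
      using below[OF r(1,2)] arith.compactin_imp_mtotally_bounded by (simp add: asym_topology_def)
    then obtain K where K: "finite K" "K \<subseteq> forward_cball p r"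
        "forward_cball p r \<subseteq> (\<Union>x\<in>K. arith.mball x (\<epsilon>/2))"
      unfolding arith.mtotally_bounded_def using \<open>\<epsilon> > 0\<close> by (metis half_gt_zero)
    have "y \<in> (\<Union>x\<in>K. arith.mball x \<epsilon>)" if y: "y \<in> forward_cball p R" for y
    proof -
      obtain z where z: "z \<in> forward_cball p r" "y \<in> arith.mball z (\<epsilon>/2)"
        using \<delta>[OF r(1,3)] y by blast
      then obtain x where "x \<in> K" "z \<in> arith.mball x (\<epsilon>/2)"
        using K by blast
      then show ?thesis
        using z arith.triangle[of x z y] by force
    qed
    moreover have "K \<subseteq> forward_cball p R"
      using K(2) forward_cball_mono[of r R p] r by auto
    ultimately show "\<exists>K. finite K \<and> K \<subseteq> forward_cball p R
        \<and> forward_cball p R \<subseteq> (\<Union>x\<in>K. arith.mball x \<epsilon>)"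
      using K(1) by blast
  qed
  then show ?thesis
    using arith.mtotally_bounded_eq_compact_closure_of[OF complete_space_imp_mcomplete[OF complete]]
      closure_of_closedin[OF closedin_forward_cball[OF p]]
    by (simp add: asym_topology_def)
qed

lemma compactin_forward_cball_extend:
  assumes cs: "convergence_symmetric" and ls: "length_space"
    and lc: "locally_compact_space asym_topology"
    and p: "p \<in> M" and "R \<ge> 0"
    and cpt: "compactin asym_topology (forward_cball p R)"
  obtains r where "r > R" "compactin asym_topology (forward_cball p r)"
proof -
  have "Hausdorff_space asym_topology"
    by (simp add: asym_topology_def arith.Hausdorff_space_mtopology)
  then obtain U L where UL: "openin asym_topology U" "compactin asym_topology L"
      "forward_cball p R \<subseteq> U" "U \<subseteq> L"
    using lc cpt locally_compact_space_compact_closed_compact[of asym_topology] by blast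
  obtain \<epsilon> where "\<epsilon> > 0" and \<epsilon>: "\<And>x. x \<in> forward_cball p R \<Longrightarrow> arith.mball x \<epsilon> \<subseteq> U"
    using arith.lebesgue_number[of "forward_cball p R" "{U}"] cpt UL
    by (auto simp: asym_topology_def)
  obtain \<delta> where "\<delta> > 0" and \<delta>: "\<And>r s. \<lbrakk>0 \<le> r; s < r + \<delta>\<rbrakk>
      \<Longrightarrow> forward_cball p s \<subseteq> (\<Union>z\<in>forward_cball p r. arith.mball z \<epsilon>)"
    using forward_cball_subset_neighbourhood[OF cs ls p \<open>\<epsilon> > 0\<close>] by blast
  have "forward_cball p (R + \<delta>/2) \<subseteq> (\<Union>z\<in>forward_cball p R. arith.mball z \<epsilon>)"
    using \<delta> \<open>\<delta> > 0\<close> \<open>R \<ge> 0\<close> by simp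
  also have "\<dots> \<subseteq> L"
    using \<epsilon> UL(4) by blast
  finally have "compactin asym_topology (forward_cball p (R + \<delta>/2))"
    using closed_compactin[OF UL(2) _ closedin_forward_cball[OF p]] by blast
  with \<open>\<delta> > 0\<close> show thesis
    by (intro that[of "R + \<delta>/2"]) auto
qed

lemma compactin_forward_cball:
  assumes cs: "convergence_symmetric" and ls: "length_space" and complete: "complete_space"
    and lc: "locally_compact_space asym_topology" and p: "p \<in> M"
  shows "compactin asym_topology (forward_cball p r)"
proof (rule ccontr)
  assume r: "\<not> compactin asym_topology (forward_cball p r)"
  define S where "S = {s. 0 \<le> s \<and> compactin asym_topology (forward_cball p s)}"
  have down: "compactin asym_topology (forward_cball p s)" if "t \<in> S" "s \<le> t" for s t
    using that closed_compactin[OF _ forward_cball_mono[OF that(2)] closedin_forward_cball[OF p]]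
    by (simp add: S_def)
  have "forward_cball p 0 = {p}"
    using p nonneg zero by (force simp: forward_cball_def)
  then have "0 \<in> S"
    using p by (simp add: S_def asym_topology_def)
  have "s \<le> r" if "s \<in> S" for s
    using r down[OF that, of r] by linarith
  then have bdd: "bdd_above S"
    by (auto simp: bdd_above_def)
  define R where "R = Sup S"
  have "0 \<le> R"
    unfolding R_def using \<open>0 \<in> S\<close> bdd by (rule cSup_upper)
  \<comment> \<open>If \<open>R = 0\<close> there are no smaller balls to approximate from, but then the ball is \<open>{p}\<close>.\<close>
  have "compactin asym_topology (forward_cball p R)"
  proof (cases "R = 0")
    case True
    then show ?thesis
      using \<open>0 \<in> S\<close> by (simp add: S_def)
  next
    case False
    show ?thesis
    proof (rule compactin_forward_cball_limit[OF cs ls complete p])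
      show "0 < R"
        using False \<open>0 \<le> R\<close> by simp
      show "compactin asym_topology (forward_cball p s)" if "s < R" for s
        using that less_cSup_iff[of S s] \<open>0 \<in> S\<close> bdd down unfolding R_def by fastforce
    qed
  qed
  then obtain t where "t > R" "compactin asym_topology (forward_cball p t)"
    using compactin_forward_cball_extend[OF cs ls lc p \<open>0 \<le> R\<close>] by blast
  then have "t \<in> S"
    using \<open>0 \<le> R\<close> by (simp add: S_def)
  then show False
    using cSup_upper[OF _ bdd] \<open>t > R\<close> unfolding R_def by fastforce
qed

lemma bounded_subset_imp_subset_forward_cball:
  assumes "bounded_subset A" "p \<in> A"
  obtains r where "A \<subseteq> forward_cball p r"
proof -
  obtain r where "\<And>x y. \<lbrakk>x \<in> A; y \<in> A\<rbrakk> \<Longrightarrow> d x y \<le> r"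
    using assms unfolding bounded_subset_def bdd_above_def by blast
  then show thesis
    using assms that[of r] by (auto simp: bounded_subset_def forward_cball_def)
qed

end

theorem theorem7p19:
  fixes M :: "'a set" and d :: "'a \<Rightarrow> 'a \<Rightarrow> real"
  assumes "asym_metric_space M d"
    and "asym_metric_space.convergence_symmetric M d"
    and "asym_metric_space.length_space M d"
    and "asym_metric_space.complete_space M d"
    and "locally_compact_space (asym_metric_space.asym_topology M d)"
  shows "\<forall>A. asym_metric_space.bounded_subset M d A \<and>
             closedin (asym_metric_space.asym_topology M d) A \<longrightarrow>
             compactin (asym_metric_space.asym_topology M d) A"
proof (intro allI impI, elim conjE)
  interpret asym_metric_space M d by fact
  fix A assume A: "bounded_subset A" "closedin asym_topology A"
  show "compactin asym_topology A"
  proof (cases "A = {}")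
    case False
    then obtain p where "p \<in> A"
      by blast
    then obtain r where "A \<subseteq> forward_cball p r"
      using bounded_subset_imp_subset_forward_cball[OF A(1)] by blast
    moreover have "p \<in> M"
      using A(1) \<open>p \<in> A\<close> by (auto simp: bounded_subset_def)
    ultimately show ?thesis
      using closed_compactin[OF compactin_forward_cball[OF assms(2-5)] _ A(2)] by blast
  qed simp
qed

end
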